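(* Let $\{G_{\lambda}\}_{\lambda \in \Lambda}$ be a family of groups indexed by a nonempty set $\Lambda$, and let $G = \bigoplus_{\lambda \in \Lambda} G_{\lambda}$. Then: (a) $G$ has a proper essential subgroup if and only if at least one of the components $G_\lambda$ of $G$ has a proper essential subgroup. (b) $e(G) = \bigoplus_{\lambda \in \Lambda} e(G_{\lambda})$.
   Context: $\bigoplus_{\lambda \in \Lambda} G_{\lambda}$ denotes the direct sum (restricted direct product) of the groups $G_\lambda$, i.e. the subgroup of $\prod_{\lambda} G_\lambda$ consisting of the elements with only finitely many nontrivial coordinates; the groups need not be abelian. For subgroups $A_\lambda \le G_\lambda$, $\bigoplus_\lambda A_\lambda$ is regarded as a subgroup of $\bigoplus_\lambda G_\lambda$. A normal subgroup $E$ of a group $G$ is called an essential subgroup of $G$ if every nontrivial normal subgroup of $G$ intersects $E$ nontrivially; it is a proper essential subgroup if moreover $E \neq G$. $e(G)$ denotes the intersection of all essential subgroups of $G$, with $e(G) = \{1\}$ if $G = \{1\}$. *)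

theory Defs
  imports "HOL-Algebra.Product_Groups"
begin

definition essential_subgroup :: "'a set \<Rightarrow> ('a, 'b) monoid_scheme \<Rightarrow> bool"
  where "essential_subgroup E G \<longleftrightarrow>
    E \<lhd> G \<and> (\<forall>N. N \<lhd> G \<and> N \<noteq> {\<one>\<^bsub>G\<^esub>} \<longrightarrow> E \<inter> N \<noteq> {\<one>\<^bsub>G\<^esub>})"

definition proper_essential_subgroup :: "'a set \<Rightarrow> ('a, 'b) monoid_scheme \<Rightarrow> bool"
  where "proper_essential_subgroup E G \<longleftrightarrow> essential_subgroup E G \<and> E \<noteq> carrier G"

(* The usual convention that e(G) is trivial for the trivial group G needs no separate clause:
   G is always essential in itself, see essential_core_trivial_group below. *)
definition essential_core :: "('a, 'b) monoid_scheme \<Rightarrow> 'a set"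
  where "essential_core G = \<Inter>{E. essential_subgroup E G}"

lemma essential_subgroup_carrier:
  assumes "group G"
  shows "essential_subgroup (carrier G) G"
proof -
  interpret group G by fact
  have "carrier G \<inter> N = N" if "N \<lhd> G" for N
    using subgroup.subset[OF normal_imp_subgroup[OF that]] by blast
  moreover have "carrier G \<lhd> G"
    by (rule normal_invI[OF subgroup_self]) auto
  ultimately show ?thesis
    by (auto simp: essential_subgroup_def)
qed

lemma subgroup_essential_core:
  assumes "group G"
  shows "subgroup (essential_core G) G"
  unfolding essential_core_def
proof (rule group.subgroups_Inter[OF assms])
  show "\<And>E. E \<in> {E. essential_subgroup E G} \<Longrightarrow> subgroup E G"
    by (auto simp: essential_subgroup_def normal_imp_subgroup)
  show "{E. essential_subgroup E G} \<noteq> {}"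
    using essential_subgroup_carrier[OF assms] by blast
qed

lemma essential_core_trivial_group:
  assumes "trivial_group G"
  shows "essential_core G = {\<one>\<^bsub>G\<^esub>}"
proof -
  have "group G" and "carrier G = {\<one>\<^bsub>G\<^esub>}"
    using assms by (auto simp: trivial_group_def)
  then show ?thesis
    using subgroup.subset[OF subgroup_essential_core] subgroup.one_closed[OF subgroup_essential_core]
    by blast
qed

(* The direct sum of subgroups A i of G i, as a subset of the direct sum of the G i:
   each A i becomes a group by restricting the carrier of G i. *)
definition sum_subgroup :: "'i set \<Rightarrow> ('i \<Rightarrow> ('a, 'b) monoid_scheme) \<Rightarrow> ('i \<Rightarrow> 'a set) \<Rightarrow> ('i \<Rightarrow> 'a) set"
  where "sum_subgroup I G A = carrier (sum_group I (\<lambda>i. (G i)\<lparr>carrier := A i\<rparr>))"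

lemma sum_subgroup_alt:
  assumes "\<And>i. i \<in> I \<Longrightarrow> group (G i)" and "\<And>i. i \<in> I \<Longrightarrow> subgroup (A i) (G i)"
  shows "sum_subgroup I G A = {x \<in> carrier (sum_group I G). \<forall>i\<in>I. x i \<in> A i}"
proof -
  have "group ((G i)\<lparr>carrier := A i\<rparr>)" if "i \<in> I" for i
    using assms that by (simp add: subgroup.subgroup_is_group)
  moreover have "y \<in> carrier (G i)" if "i \<in> I" "y \<in> A i" for i y
    using subgroup.mem_carrier[OF assms(2)] that by blast
  ultimately show ?thesis
    using assms(1) by (auto simp: sum_subgroup_def carrier_sum_group PiE_iff)
qed

end

(* Preimages of essential subgroups are essential under every surjective homomorphism and under
   every embedding that maps normal subgroups to normal subgroups.  Projections and inclusions of
   the summands are of these two kinds, so essential subgroups transfer in both directions; and a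
   subgroup of the direct sum contains every element all of whose components it contains, by
   finiteness of the support. *)
theory Submission
  imports Defs
begin

section \<open>Preimages of essential subgroups\<close>

lemma (in group_hom) normal_preimage:
  assumes "N \<lhd> H"
  shows "{x \<in> carrier G. h x \<in> N} \<lhd> G"
proof -
  interpret N: normal N H by fact
  show ?thesis
  proof (rule G.normal_invI)
    show "subgroup {x \<in> carrier G. h x \<in> N} G"
      by unfold_locales auto
  qed (auto intro: N.inv_op_closed2)
qed

text \<open>A normal subgroup \<open>N\<close> of \<open>G\<close> is either killed by
  \<open>h\<close>, and then it lies inside the preimage because \<open>E\<close> contains the
  identity, or has a nontrivial image. Surjectivity makes that image normal in \<open>H\<close>, so
  it meets \<open>E\<close> in some nontrivial \<open>h x\<close> with \<open>x\<close> in
  \<open>N\<close>, and this \<open>x\<close> is the required element.\<close>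

lemma (in group_hom) essential_preimage_surj:
  assumes surj: "h ` carrier G = carrier H" and E: "essential_subgroup E H"
  shows "essential_subgroup {x \<in> carrier G. h x \<in> E} G"
  unfolding essential_subgroup_def
proof (intro conjI allI impI)
  have EH: "E \<lhd> H"
    using E by (simp add: essential_subgroup_def)
  then show "{x \<in> carrier G. h x \<in> E} \<lhd> G"
    by (rule normal_preimage)
  have oneE: "\<one>\<^bsub>H\<^esub> \<in> E"
    using EH normal_imp_subgroup subgroup.one_closed by blast
  fix N assume N: "N \<lhd> G \<and> N \<noteq> {\<one>}"
  then interpret N: normal N G by simp
  show "{x \<in> carrier G. h x \<in> E} \<inter> N \<noteq> {\<one>}"
  proof (cases "h ` N = {\<one>\<^bsub>H\<^esub>}")
    case True
    have "h n = \<one>\<^bsub>H\<^esub>" if "n \<in> N" for n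
      using imageI[OF that, of h] True by simp
    then have "N \<subseteq> {x \<in> carrier G. h x \<in> E}"
      using oneE N.subset by auto
    then show ?thesis
      using N by blast
  next
    case False
    have "h ` N \<lhd> H"
      using surj by (intro N.surj_hom_normal_subgroup) (unfold_locales, auto)
    with False E have "E \<inter> h ` N \<noteq> {\<one>\<^bsub>H\<^esub>}"
      by (simp add: essential_subgroup_def)
    \<comment> \<open>The inequality alone would also allow an empty intersection; membership of the
      identity turns it into a nontrivial common element.\<close>
    moreover have "\<one>\<^bsub>H\<^esub> \<in> E \<inter> h ` N"
      using oneE imageI[OF N.one_closed, of h] by simp
    ultimately obtain x where "x \<in> N" "h x \<in> E" "h x \<noteq> \<one>\<^bsub>H\<^esub>"
      by blast
    moreover from this have "x \<in> carrier G" "x \<noteq> \<one>"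
      by auto
    ultimately show ?thesis
      by blast
  qed
qed

text \<open>Injectivity excludes the case that \<open>h\<close> kills \<open>N\<close>, so only the
  argument with a nontrivial image remains. Normality of that image is a separate assumption, since
  \<open>h\<close> may fail to be surjective.\<close>

lemma (in group_hom) essential_preimage_inj:
  assumes inj: "inj_on h (carrier G)"
    and normal_img: "\<And>N. N \<lhd> G \<Longrightarrow> h ` N \<lhd> H"
    and E: "essential_subgroup E H"
  shows "essential_subgroup {x \<in> carrier G. h x \<in> E} G"
  unfolding essential_subgroup_def
proof (intro conjI allI impI)
  have EH: "E \<lhd> H"
    using E by (simp add: essential_subgroup_def)
  then show "{x \<in> carrier G. h x \<in> E} \<lhd> G"
    by (rule normal_preimage)
  have oneE: "\<one>\<^bsub>H\<^esub> \<in> E"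
    using EH normal_imp_subgroup subgroup.one_closed by blast
  fix N assume N: "N \<lhd> G \<and> N \<noteq> {\<one>}"
  then interpret N: normal N G by simp
  obtain n where n: "n \<in> N" "n \<noteq> \<one>"
    using N N.one_closed by blast
  then have "h n \<noteq> \<one>\<^bsub>H\<^esub>"
    using inj N.subset by (metis G.one_closed hom_one inj_onD subsetD)
  then have "h ` N \<noteq> {\<one>\<^bsub>H\<^esub>}"
    using n by blast
  then have "E \<inter> h ` N \<noteq> {\<one>\<^bsub>H\<^esub>}"
    using E normal_img N by (simp add: essential_subgroup_def)
  moreover have "\<one>\<^bsub>H\<^esub> \<in> E \<inter> h ` N"
    using oneE imageI[OF N.one_closed, of h] by simp
  ultimately obtain x where "x \<in> N" "h x \<in> E" "h x \<noteq> \<one>\<^bsub>H\<^esub>"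
    by blast
  moreover from this have "x \<in> carrier G" "x \<noteq> \<one>"
    by auto
  ultimately show "{x \<in> carrier G. h x \<in> E} \<inter> N \<noteq> {\<one>}"
    by blast
qed

lemma essential_core_subset: "essential_subgroup E G \<Longrightarrow> essential_core G \<subseteq> E"
  by (auto simp: essential_core_def)

section \<open>Projections and inclusions of the summands\<close>

text \<open>The restriction to \<open>I\<close> yields \<open>undefined\<close> outside
  \<open>I\<close>, because the carrier of \<open>sum_group\<close> consists of extensional
  functions.\<close>

definition sum_incl :: "'i set \<Rightarrow> ('i \<Rightarrow> ('a, 'b) monoid_scheme) \<Rightarrow> 'i \<Rightarrow> 'a \<Rightarrow> 'i \<Rightarrow> 'a"
  where "sum_incl I G i y = (\<lambda>j\<in>I. if j = i then y else \<one>\<^bsub>G j\<^esub>)"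

context
  fixes I :: "'i set" and G :: "'i \<Rightarrow> ('a, 'b) monoid_scheme"
  assumes grp: "\<And>i. i \<in> I \<Longrightarrow> group (G i)"
begin

lemma sum_group_component_closed: "x \<in> carrier (sum_group I G) \<Longrightarrow> i \<in> I \<Longrightarrow> x i \<in> carrier (G i)"
  by (auto simp: carrier_sum_group grp)

lemma sum_incl_closed:
  assumes "i \<in> I" "y \<in> carrier (G i)"
  shows "sum_incl I G i y \<in> carrier (sum_group I G)"
proof -
  have "{j \<in> I. sum_incl I G i y j \<noteq> \<one>\<^bsub>G j\<^esub>} \<subseteq> {i}"
    by (auto simp: sum_incl_def)
  then have "finite {j \<in> I. sum_incl I G i y j \<noteq> \<one>\<^bsub>G j\<^esub>}"
    using finite_subset by blast
  moreover have "sum_incl I G i y \<in> (\<Pi>\<^sub>E j\<in>I. carrier (G j))"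
    using assms grp by (auto simp: sum_incl_def group.is_monoid)
  ultimately show ?thesis
    by (simp add: carrier_sum_group grp)
qed

lemma group_hom_sum_proj: "i \<in> I \<Longrightarrow> group_hom (sum_group I G) (G i) (\<lambda>x. x i)"
  by (auto simp: group_hom_def group_hom_axioms_def hom_def grp carrier_sum_group PiE_iff)

lemma sum_proj_surj:
  assumes "i \<in> I"
  shows "(\<lambda>x. x i) ` carrier (sum_group I G) = carrier (G i)"
proof
  show "(\<lambda>x. x i) ` carrier (sum_group I G) \<subseteq> carrier (G i)"
    using assms by (auto simp: carrier_sum_group grp PiE_iff)
  show "carrier (G i) \<subseteq> (\<lambda>x. x i) ` carrier (sum_group I G)"
  proof
    fix y assume "y \<in> carrier (G i)"
    then have "sum_incl I G i y \<in> carrier (sum_group I G)"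
      by (rule sum_incl_closed[OF assms])
    moreover have "y = sum_incl I G i y i"
      using assms by (simp add: sum_incl_def)
    ultimately show "y \<in> (\<lambda>x. x i) ` carrier (sum_group I G)"
      by (intro image_eqI[of _ _ "sum_incl I G i y"])
  qed
qed

lemma group_hom_sum_incl:
  assumes "i \<in> I"
  shows "group_hom (G i) (sum_group I G) (sum_incl I G i)"
proof -
  \<comment> \<open>Coordinates other than \<open>i\<close> only need that the identity times itself
    is the identity, so no closure assumption on \<open>x\<close> and \<open>y\<close>
    enters.\<close>
  have "sum_incl I G i (x \<otimes>\<^bsub>G i\<^esub> y) = sum_incl I G i x \<otimes>\<^bsub>sum_group I G\<^esub> sum_incl I G i y" for x y
    using grp by (auto simp: sum_incl_def fun_eq_iff group.is_monoid)
  then show ?thesis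
    using assms grp sum_incl_closed by (auto simp: group_hom_def group_hom_axioms_def hom_def)
qed

lemma inj_sum_incl: "i \<in> I \<Longrightarrow> inj_on (sum_incl I G i) A"
  by (rule inj_onI, drule fun_cong[where x = i]) (simp add: sum_incl_def)

text \<open>Conjugation in the sum is coordinatewise: at \<open>i\<close> it conjugates within
  \<open>N\<close>, and at every other coordinate it fixes the identity. This supplies the
  assumption on images in \<open>essential_preimage_inj\<close>.\<close>

lemma normal_sum_incl_image:
  assumes i: "i \<in> I" and N: "N \<lhd> G i"
  shows "sum_incl I G i ` N \<lhd> sum_group I G"
proof (rule group.normal_invI)
  interpret N: normal N "G i" by fact
  show "group (sum_group I G)"
    by (simp add: grp)
  show "subgroup (sum_incl I G i ` N) (sum_group I G)"
    using group_hom.subgroup_img_is_subgroup[OF group_hom_sum_incl[OF i]] N.subgroup_axioms by blast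
  fix x h assume x: "x \<in> carrier (sum_group I G)" and "h \<in> sum_incl I G i ` N"
  then obtain n where n: "n \<in> N" "h = sum_incl I G i n"
    by blast
  have "x \<otimes>\<^bsub>sum_group I G\<^esub> h \<otimes>\<^bsub>sum_group I G\<^esub> inv\<^bsub>sum_group I G\<^esub> x
      = sum_incl I G i (x i \<otimes>\<^bsub>G i\<^esub> n \<otimes>\<^bsub>G i\<^esub> inv\<^bsub>G i\<^esub> x i)"
    using x by (auto simp: grp n sum_incl_def fun_eq_iff group.is_monoid group.r_inv
        carrier_sum_group PiE_iff)
  moreover have "x i \<otimes>\<^bsub>G i\<^esub> n \<otimes>\<^bsub>G i\<^esub> inv\<^bsub>G i\<^esub> x i \<in> N"
    using n x i by (intro N.inv_op_closed2 sum_group_component_closed)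
  ultimately show "x \<otimes>\<^bsub>sum_group I G\<^esub> h \<otimes>\<^bsub>sum_group I G\<^esub> inv\<^bsub>sum_group I G\<^esub> x \<in> sum_incl I G i ` N"
    by simp
qed

text \<open>Passage from a summand up to the sum; it confines the core of the sum coordinate by
  coordinate.\<close>

lemma essential_cylinder:
  assumes "i \<in> I" "essential_subgroup E (G i)"
  shows "essential_subgroup {x \<in> carrier (sum_group I G). x i \<in> E} (sum_group I G)"
  by (rule group_hom.essential_preimage_surj
      [OF group_hom_sum_proj[OF assms(1)] sum_proj_surj[OF assms(1)] assms(2)])

text \<open>Passage from the sum down to a summand; it places the core of \<open>G i\<close>,
  embedded in the sum, inside every essential \<open>E\<close>.\<close>

lemma essential_slice:
  assumes "i \<in> I" "essential_subgroup E (sum_group I G)"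
  shows "essential_subgroup {y \<in> carrier (G i). sum_incl I G i y \<in> E} (G i)"
  by (rule group_hom.essential_preimage_inj
      [OF group_hom_sum_incl[OF assms(1)] inj_sum_incl[OF assms(1)] _ assms(2)])
    (rule normal_sum_incl_image[OF assms(1)])

text \<open>An element of the direct sum is the product of the embedded copies of its coordinates
  over its finite support, so the summands generate the sum.\<close>

lemma mem_subgroup_sum_groupI:
  assumes S: "subgroup S (sum_group I G)" and "x \<in> carrier (sum_group I G)"
    and "\<And>i. i \<in> I \<Longrightarrow> sum_incl I G i (x i) \<in> S"
  shows "x \<in> S"
proof -
  interpret S: subgroup S "sum_group I G" by fact
  \<comment> \<open>The induction runs over any finite \<open>F\<close> covering the support, so
    that \<open>k\<close> can be removed from \<open>F\<close> whether or not \<open>x k\<close> is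
    trivial.\<close>
  have "finite F \<Longrightarrow> x \<in> carrier (sum_group I G) \<Longrightarrow> {i \<in> I. x i \<noteq> \<one>\<^bsub>G i\<^esub>} \<subseteq> F \<Longrightarrow>
      (\<And>i. i \<in> I \<Longrightarrow> sum_incl I G i (x i) \<in> S) \<Longrightarrow> x \<in> S" for F x
  proof (induction F arbitrary: x rule: finite_induct)
    case empty
    then have "x = \<one>\<^bsub>sum_group I G\<^esub>"
      by (auto simp: carrier_sum_group grp fun_eq_iff PiE_iff extensional_def)
    then show ?case
      using S.one_closed by (simp only:)
  next
    case (insert k F)
    show ?case
    proof (cases "k \<in> I")
      \<comment> \<open>An index outside \<open>I\<close> is never in the support, so
        \<open>F\<close> already covers it.\<close>
      case False
      then show ?thesis
        using insert.IH[OF insert.prems(1) _ insert.prems(3)] insert.prems(2) by blast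
    next
      case k: True
      \<comment> \<open>Resetting coordinate \<open>k\<close> shrinks the support into
        \<open>F\<close>, which makes \<open>y\<close> accessible to the induction hypothesis;
        \<open>x\<close> is recovered by multiplying with the embedded \<open>x k\<close>.\<close>
      define y where "y = x(k := \<one>\<^bsub>G k\<^esub>)"
      have "{i \<in> I. y i \<noteq> \<one>\<^bsub>G i\<^esub>} \<subseteq> {i \<in> I. x i \<noteq> \<one>\<^bsub>G i\<^esub>}"
        by (auto simp: y_def)
      then have "finite {i \<in> I. y i \<noteq> \<one>\<^bsub>G i\<^esub>}"
        by (rule finite_subset) (use insert.prems(1) in \<open>simp add: carrier_sum_group grp\<close>)
      then have y: "y \<in> carrier (sum_group I G)"
        using insert.prems(1) k
        by (simp add: carrier_sum_group grp PiE_iff extensional_def group.is_monoid y_def)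
      have supp: "{i \<in> I. y i \<noteq> \<one>\<^bsub>G i\<^esub>} \<subseteq> F"
        using insert.prems(2) by (auto simp: y_def)
      have "sum_incl I G i (y i) \<in> S" if "i \<in> I" for i
      proof (cases "i = k")
        case True
        then have "sum_incl I G i (y i) = \<one>\<^bsub>sum_group I G\<^esub>"
          by (auto simp: sum_incl_def y_def)
        then show ?thesis
          using S.one_closed by (simp only:)
      qed (use insert.prems(3)[OF that] in \<open>simp add: y_def\<close>)
      then have "y \<in> S"
        by (rule insert.IH[OF y supp])
      \<comment> \<open>In each coordinate one of the two factors is the identity; outside
        \<open>I\<close> both sides are \<open>undefined\<close>.\<close>
      moreover have "sum_incl I G k (x k) \<otimes>\<^bsub>sum_group I G\<^esub> y = x"
      proof
        fix i show "(sum_incl I G k (x k) \<otimes>\<^bsub>sum_group I G\<^esub> y) i = x i"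
          using insert.prems(1)
          by (cases "i \<in> I") (auto simp: carrier_sum_group grp PiE_iff extensional_def
              group.is_monoid sum_incl_def y_def)
      qed
      ultimately show ?thesis
        using S.m_closed[OF insert.prems(3)[OF k]] by metis
    qed
  qed
  from this[of "{i \<in> I. x i \<noteq> \<one>\<^bsub>G i\<^esub>}"] show ?thesis
    using assms by (simp add: carrier_sum_group grp)
qed

text \<open>If \<open>E\<close> misses \<open>x\<close>, it misses some embedded coordinate of
  \<open>x\<close>, so the slice of \<open>E\<close> at that index misses \<open>x i\<close>.
  Conversely, if \<open>E\<close> misses \<open>y\<close> in \<open>G i\<close>, the cylinder over
  \<open>E\<close> misses any element projecting to \<open>y\<close>.\<close>

lemma proper_essential_sum_group_iff:
  "(\<exists>E. proper_essential_subgroup E (sum_group I G)) \<longleftrightarrow>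
    (\<exists>i\<in>I. \<exists>E. proper_essential_subgroup E (G i))"
proof
  assume "\<exists>E. proper_essential_subgroup E (sum_group I G)"
  then obtain E where E: "essential_subgroup E (sum_group I G)" "E \<noteq> carrier (sum_group I G)"
    by (auto simp: proper_essential_subgroup_def)
  then have sub: "subgroup E (sum_group I G)"
    by (simp add: essential_subgroup_def normal_imp_subgroup)
  then obtain x where x: "x \<in> carrier (sum_group I G)" "x \<notin> E"
    using E(2) subgroup.subset by blast
  then obtain i where i: "i \<in> I" "sum_incl I G i (x i) \<notin> E"
    using mem_subgroup_sum_groupI[OF sub] by blast
  then have "proper_essential_subgroup {y \<in> carrier (G i). sum_incl I G i y \<in> E} (G i)"
    using essential_slice[OF i(1) E(1)] sum_group_component_closed[OF x(1) i(1)]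
    by (auto simp: proper_essential_subgroup_def)
  then show "\<exists>i\<in>I. \<exists>E. proper_essential_subgroup E (G i)"
    using i(1) by blast
next
  assume "\<exists>i\<in>I. \<exists>E. proper_essential_subgroup E (G i)"
  then obtain i E where i: "i \<in> I" and E: "essential_subgroup E (G i)" "E \<noteq> carrier (G i)"
    by (auto simp: proper_essential_subgroup_def)
  then obtain y where y: "y \<in> carrier (G i)" "y \<notin> E"
    using subgroup.subset[OF normal_imp_subgroup] by (metis essential_subgroup_def subsetI subset_antisym)
  from y(1) have "y \<in> (\<lambda>x. x i) ` carrier (sum_group I G)"
    by (simp only: sum_proj_surj[OF i])
  then obtain x where "x \<in> carrier (sum_group I G)" "x i \<notin> E"
    using y(2) by (elim imageE) simp
  then have "proper_essential_subgroup {x \<in> carrier (sum_group I G). x i \<in> E} (sum_group I G)"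
    using essential_cylinder[OF i E(1)] by (auto simp: proper_essential_subgroup_def)
  then show "\<exists>E. proper_essential_subgroup E (sum_group I G)" ..
qed

text \<open>If every coordinate of \<open>x\<close> lies in the core of its summand, then it lies in
  each slice of each essential \<open>E\<close>, and \<open>x\<close> is assembled in
  \<open>E\<close> from these coordinates. The reverse inclusion holds because the cylinders are
  among the subgroups intersected.\<close>

lemma essential_core_sum_group:
  "essential_core (sum_group I G) = sum_subgroup I G (\<lambda>i. essential_core (G i))"
proof -
  have "sum_subgroup I G (\<lambda>i. essential_core (G i))
      = {x \<in> carrier (sum_group I G). \<forall>i\<in>I. x i \<in> essential_core (G i)}"
    by (intro sum_subgroup_alt grp subgroup_essential_core)
  also have "\<dots> = essential_core (sum_group I G)"
  proof (intro equalityI subsetI)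
    fix x assume x: "x \<in> {x \<in> carrier (sum_group I G). \<forall>i\<in>I. x i \<in> essential_core (G i)}"
    have "x \<in> E" if E: "essential_subgroup E (sum_group I G)" for E
    proof (rule mem_subgroup_sum_groupI)
      show "subgroup E (sum_group I G)"
        using E by (simp add: essential_subgroup_def normal_imp_subgroup)
      show "sum_incl I G i (x i) \<in> E" if "i \<in> I" for i
        using essential_core_subset[OF essential_slice[OF that E]] x that by blast
    qed (use x in simp)
    then show "x \<in> essential_core (sum_group I G)"
      by (simp add: essential_core_def)
  next
    fix x assume x: "x \<in> essential_core (sum_group I G)"
    then have "x \<in> carrier (sum_group I G)"
      using essential_core_subset[OF essential_subgroup_carrier] grp sum_group by blast
    moreover have "x i \<in> E" if "i \<in> I" "essential_subgroup E (G i)" for i E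
      using essential_core_subset[OF essential_cylinder[OF that]] x by blast
    ultimately show "x \<in> {x \<in> carrier (sum_group I G). \<forall>i\<in>I. x i \<in> essential_core (G i)}"
      by (simp add: essential_core_def)
  qed
  finally show ?thesis ..
qed

end

theorem theorem2p8:
  fixes \<Lambda> :: "'i set" and G :: "'i \<Rightarrow> ('a, 'b) monoid_scheme"
  assumes "\<Lambda> \<noteq> {}"
    and "\<And>i. i \<in> \<Lambda> \<Longrightarrow> group (G i)"
  shows "((\<exists>E. proper_essential_subgroup E (sum_group \<Lambda> G)) \<longleftrightarrow>
            (\<exists>i\<in>\<Lambda>. \<exists>E. proper_essential_subgroup E (G i))) \<and>
         essential_core (sum_group \<Lambda> G) = sum_subgroup \<Lambda> G (\<lambda>i. essential_core (G i))"
  using assms(2) by (simp add: proper_essential_sum_group_iff essential_core_sum_group)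

end
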